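(* Let $\mathcal G^0=(\mathcal V,\mathcal E^0)$ be a graph with $N$ vertices (the nominal graph), let $p\in[0,1]$, and let $L_\sigma$ be the random Laplacian of the graph obtained from $\mathcal G^0$ under Bernoulli packet loss with transmission probability $p$ (as defined in the context). There exists a similarity transformation $U$ (an invertible $N\times N$ matrix, complex entries allowed) that diagonalizes $\mathbb E[L_\sigma]$, $\mathbb E[L_\sigma^T]$ and $\mathbb E[L_\sigma^TL_\sigma]$ if and only if $L(\mathcal G^0)$ is normal, i.e. $L(\mathcal G^0)L(\mathcal G^0)^T=L(\mathcal G^0)^TL(\mathcal G^0)$.
   Context: Graphs: a (directed) graph $\mathcal G=(\mathcal V,\mathcal E)$ has vertex set $\mathcal V=\{v_1,\dots,v_N\}$ and edge set $\mathcal E\subset\mathcal V\times\mathcal V$ without self-loops; $e_{ij}=(v_j,v_i)$ is the edge from $v_j$ to $v_i$. The in-neighbourhood of $v_i$ is $\mathcal N_i^-=\{v_j\in\mathcal V: e_{ij}\in\mathcal E\}$, with $d_i^-=|\mathcal N_i^-|$. The Laplacian $L(\mathcal G)=[l_{ij}]$ has $l_{ij}=-1$ if $i\ne j$ and $v_j\in\mathcal N_i^-$, $l_{ij}=0$ if $i\neq j$ and $v_j\notin\mathcal N_i^-$, and $l_{ii}=d_i^-$. Packet loss model: to each edge $e_{ij}\in\mathcal E^0$ is attached a stationary stochastic process $\alpha_{ij}(k)\in\{0,1\}$, $k\ge0$ ($1$: packet transmitted, $0$: packet lost), with $\Pr(\alpha_{ij}(k)=1)=p$ and $\Pr(\alpha_{ij}(k)=0)=1-p$,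 where $p\in[0,1]$ is the same for all edges. For all $k,k'\ge0$ and $e_{ij},e_{rs}\in\mathcal E^0$, the variables $\alpha_{ij}(k)$ and $\alpha_{rs}(k')$ are independent whenever $k\ne k'$ or [$(r,s)\neq(i,j)$ and $(r,s)\ne(j,i)$]. The random Laplacian $L_{\sigma(k)}=[l^\sigma_{ij}(k)]$ is, with $\mathcal N_i^-$ the in-neighbourhoods in $\mathcal G^0$: $l^\sigma_{ij}(k)=-\alpha_{ij}(k)$ if $i\neq j$ and $v_j\in\mathcal N_i^-$; $l^\sigma_{ij}(k)=0$ if $i\ne j$ and $v_j\notin\mathcal N_i^-$; $l^\sigma_{ii}(k)=\sum_{v_m\in\mathcal N_i^-}\alpha_{im}(k)$. By stationarity the time index $k$ is dropped, and $L_\sigma$ denotes $L_{\sigma(k)}$ at any fixed time; $\mathbb E$ is the expectation with respect to the packet loss. "$U$ diagonalizes $M$" means $UMU^{-1}$ is diagonal; the same $U$ is to diagonalize all three matrices.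
   Formalization: For p = 0 only "normal implies diagonalizable" is claimed, since the converse fails there (all three expectations vanish, so the identity diagonalizes them for any graph, e.g. two vertices with one edge); for p in (0,1] the full equivalence is proved. *)

theory Defs
  imports
    "HOL-Probability.Probability"
    "Jordan_Normal_Form.Matrix"
    "Graph_Theory.Pair_Digraph"
begin

text \<open>
  The vertices \<open>v\<^sub>1, \<dots>, v\<^sub>N\<close> are represented by the indices \<open>0, \<dots>, N - 1\<close>.  The edge
  \<open>e\<^sub>i\<^sub>j = (v\<^sub>j, v\<^sub>i)\<close> from \<open>v\<^sub>j\<close> to \<open>v\<^sub>i\<close> is the arc \<open>(j, i)\<close>, whereas its transmission process
  is written \<open>\<alpha> i j\<close>, with the indices in the order of \<open>e\<^sub>i\<^sub>j\<close>.
\<close>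

definition in_nbrs :: "nat pair_pre_digraph \<Rightarrow> nat \<Rightarrow> nat set" where
  "in_nbrs G i = {j \<in> pverts G. (j, i) \<in> parcs G}"

definition laplacian :: "nat \<Rightarrow> nat pair_pre_digraph \<Rightarrow> real mat" where
  "laplacian N G = mat N N (\<lambda>(i, j).
     if i = j then real (card (in_nbrs G i))
     else if j \<in> in_nbrs G i then - 1 else 0)"

text \<open>
  The two sides below are the laws of the whole path and of the path shifted by \<open>h\<close>, as
  measures on the product space, so this is stationarity in the strict sense.
\<close>

definition (in prob_space) stationary_process :: "(nat \<Rightarrow> 'a \<Rightarrow> real) \<Rightarrow> bool" where
  "stationary_process X \<longleftrightarrow>
     (\<forall>k. random_variable borel (X k)) \<and>
     (\<forall>h. distr M (\<Pi>\<^sub>M k\<in>UNIV. borel) (\<lambda>\<omega> k. X (k + h) \<omega>) =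
          distr M (\<Pi>\<^sub>M k\<in>UNIV. borel) (\<lambda>\<omega> k. X k \<omega>))"

text \<open>
  Independence is required pairwise only, and at equal times nothing is assumed about the joint
  law of \<open>\<alpha> i j k\<close> and \<open>\<alpha> j i k\<close>.
\<close>

locale bernoulli_packet_loss = prob_space M
  for M :: "'a measure"
    and G :: "nat pair_pre_digraph"
    and p :: real
    and \<alpha> :: "nat \<Rightarrow> nat \<Rightarrow> nat \<Rightarrow> 'a \<Rightarrow> real" +
  assumes prob_range: "p \<in> {0..1}"
    and binary: "\<And>i j k \<omega>. (j, i) \<in> parcs G \<Longrightarrow> \<omega> \<in> space M \<Longrightarrow> \<alpha> i j k \<omega> \<in> {0, 1}"
    and stationary: "\<And>i j. (j, i) \<in> parcs G \<Longrightarrow> stationary_process (\<alpha> i j)"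
    and prob_transmitted:
      "\<And>i j k. (j, i) \<in> parcs G \<Longrightarrow> prob {\<omega> \<in> space M. \<alpha> i j k \<omega> = 1} = p"
    and prob_lost:
      "\<And>i j k. (j, i) \<in> parcs G \<Longrightarrow> prob {\<omega> \<in> space M. \<alpha> i j k \<omega> = 0} = 1 - p"
    and independent:
      "\<And>i j r s k k'. (j, i) \<in> parcs G \<Longrightarrow> (s, r) \<in> parcs G \<Longrightarrow>
         k \<noteq> k' \<or> ((r, s) \<noteq> (i, j) \<and> (r, s) \<noteq> (j, i)) \<Longrightarrow>
         indep_var borel (\<alpha> i j k) borel (\<alpha> r s k')"

definition random_laplacian ::
    "nat \<Rightarrow> nat pair_pre_digraph \<Rightarrow> (nat \<Rightarrow> nat \<Rightarrow> nat \<Rightarrow> 'a \<Rightarrow> real) \<Rightarrow> nat \<Rightarrow> 'a \<Rightarrow> real mat" where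
  "random_laplacian N G \<alpha> k \<omega> = mat N N (\<lambda>(i, j).
     if i = j then (\<Sum>m\<in>in_nbrs G i. \<alpha> i m k \<omega>)
     else if j \<in> in_nbrs G i then - \<alpha> i j k \<omega> else 0)"

definition mat_expectation :: "nat \<Rightarrow> 'a measure \<Rightarrow> ('a \<Rightarrow> real mat) \<Rightarrow> real mat" where
  "mat_expectation N M X = mat N N (\<lambda>(i, j). \<integral>\<omega>. X \<omega> $$ (i, j) \<partial>M)"

text \<open>Here \<open>V\<close> is the inverse of \<open>U\<close>.\<close>

definition diagonalizes :: "complex mat \<Rightarrow> complex mat \<Rightarrow> bool" where
  "diagonalizes U A \<longleftrightarrow>
     (\<exists>V. inverts_mat U V \<and> inverts_mat V U \<and> diagonal_mat (U * A * V))"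

definition simultaneously_diagonalizable :: "nat \<Rightarrow> real mat set \<Rightarrow> bool" where
  "simultaneously_diagonalizable N As \<longleftrightarrow>
     (\<exists>U \<in> carrier_mat N N. \<forall>A \<in> As. diagonalizes U (map_mat complex_of_real A))"

definition normal_mat :: "real mat \<Rightarrow> bool" where
  "normal_mat A \<longleftrightarrow> A * transpose_mat A = transpose_mat A * A"

end

theory Submission
  imports Defs "Jordan_Normal_Form.Jordan_Normal_Form_Uniqueness"
    "Jordan_Normal_Form.Jordan_Normal_Form_Existence"
begin

text \<open>
  Let \<open>L\<close> be the nominal Laplacian.  Then \<open>E[L\<^sub>\<sigma>] = p L\<close>, so if one \<open>U\<close> diagonalizes \<open>E[L\<^sub>\<sigma>]\<close> and
  \<open>E[L\<^sub>\<sigma>\<^sup>T]\<close>, then \<open>L\<close> and \<open>L\<^sup>T\<close> commute, provided \<open>p \<noteq> 0\<close>.  Conversely, only packets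
  received by a common vertex meet in an entry of \<open>L\<^sub>\<sigma>\<^sup>T L\<^sub>\<sigma>\<close>, and those of distinct edges are
  independent, whence
  \<open>E[L\<^sub>\<sigma>\<^sup>T L\<^sub>\<sigma>] = p\<^sup>2 L\<^sup>T L + (p - p\<^sup>2) S\<close>, where \<open>S\<close> is the sum over all edges of the outer squares
  of their incidence vectors.  If \<open>L\<close> is normal, then \<open>L 1 = 0\<close> forces \<open>L\<^sup>T 1 = 0\<close>, which turns \<open>S\<close>
  into \<open>L + L\<^sup>T\<close>.  Moreover \<open>ker (L - e)\<^sup>2 = ker (L - e)\<close> for every \<open>e\<close>, so the Jordan blocks of \<open>L\<close>
  have size 1, and each eigenvector of \<open>L\<close> is one of \<open>L\<^sup>T\<close>; hence a diagonalization of \<open>L\<close> also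
  diagonalizes \<open>L\<^sup>T\<close> and thereby all three matrices.
\<close>

unbundle no inner_syntax and no vec_syntax

section \<open>Normal matrices\<close>

abbreviation conj_transpose :: "complex mat \<Rightarrow> complex mat" where
  "conj_transpose A \<equiv> map_mat cnj (transpose_mat A)"

text \<open>\<open>\<bullet>c\<close> conjugates its second argument, so the transpose that moves
  across the bilinear product becomes the adjoint.\<close>

lemma scalar_prod_conj_transpose:
  assumes A: "A \<in> carrier_mat n n" and x: "x \<in> carrier_vec n" and y: "y \<in> carrier_vec n"
  shows "(A *\<^sub>v x) \<bullet>c y = x \<bullet>c (conj_transpose A *\<^sub>v y)"
proof -
  have "conjugate (conj_transpose A *\<^sub>v y) = transpose_mat A *\<^sub>v conjugate y"
    using A y by (intro eq_vecI) (auto simp: scalar_prod_def intro!: sum.cong)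
  moreover have "(A *\<^sub>v x) \<bullet>c y = (transpose_mat A *\<^sub>v conjugate y) \<bullet> x"
    using A x y by (subst transpose_vec_mult_scalar[of _ n n]) (auto intro: comm_scalar_prod[of _ n])
  ultimately show ?thesis
    using A x y by (simp add: comm_scalar_prod[of _ n])
qed

text \<open>Write \<open>H\<close> for the adjoint. Since \<open>A\<close> and \<open>H\<close>
  commute, \<open>A\<close> also kills \<open>H v\<close>; pairing \<open>A (H v) = 0\<close> with
  \<open>v\<close> gives the squared norm of \<open>H v\<close>.\<close>

lemma normal_kernel_conj_transpose:
  assumes A: "A \<in> carrier_mat n n" and normal: "A * conj_transpose A = conj_transpose A * A"
    and v: "v \<in> carrier_vec n" and Av: "A *\<^sub>v v = 0\<^sub>v n"
  shows "conj_transpose A *\<^sub>v v = 0\<^sub>v n"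
proof -
  let ?H = "conj_transpose A"
  have H: "?H \<in> carrier_mat n n" using A by auto
  have "A *\<^sub>v (?H *\<^sub>v v) = ?H *\<^sub>v (A *\<^sub>v v)"
    using A H v by (metis assoc_mult_mat_vec normal)
  moreover have "?H *\<^sub>v 0\<^sub>v n = 0\<^sub>v n"
    using H by (intro eq_vecI) auto
  ultimately have "A *\<^sub>v (?H *\<^sub>v v) = 0\<^sub>v n"
    using Av by simp
  moreover have "(A *\<^sub>v (?H *\<^sub>v v)) \<bullet>c v = (?H *\<^sub>v v) \<bullet>c (?H *\<^sub>v v)"
    using A H v by (intro scalar_prod_conj_transpose) auto
  ultimately have "(?H *\<^sub>v v) \<bullet>c (?H *\<^sub>v v) = 0" using v by simp
  then show ?thesis using H v by (subst (asm) conjugate_square_eq_0_vec) auto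
qed

text \<open>The vector \<open>A v\<close> lies in the kernel of \<open>A\<close>, hence in that of
  the adjoint, and moving \<open>A\<close> across the product shows that its norm is zero.\<close>

lemma normal_kernel_square:
  assumes A: "A \<in> carrier_mat n n" and normal: "A * conj_transpose A = conj_transpose A * A"
    and v: "v \<in> carrier_vec n" and AAv: "A *\<^sub>v (A *\<^sub>v v) = 0\<^sub>v n"
  shows "A *\<^sub>v v = 0\<^sub>v n"
proof -
  have "conj_transpose A *\<^sub>v (A *\<^sub>v v) = 0\<^sub>v n"
    using A v by (intro normal_kernel_conj_transpose[OF A normal _ AAv]) auto
  moreover have "(A *\<^sub>v v) \<bullet>c (A *\<^sub>v v) = v \<bullet>c (conj_transpose A *\<^sub>v (A *\<^sub>v v))"
    using A v by (intro scalar_prod_conj_transpose) auto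
  ultimately have "(A *\<^sub>v v) \<bullet>c (A *\<^sub>v v) = 0" using v by simp
  then show ?thesis using A v by (subst (asm) conjugate_square_eq_0_vec) auto
qed

lemma conj_transpose_char_matrix:
  assumes "A \<in> carrier_mat n n"
  shows "conj_transpose (char_matrix A e) = char_matrix (conj_transpose A) (cnj e)"
  using assms by (intro eq_matI) (auto simp: char_matrix_def)

text \<open>\<open>char_matrix A e\<close> is \<open>A - e\<close>. Normality survives this shift,
  so the kernel lemmas above extend to eigenspaces.\<close>

lemma normal_char_matrix:
  assumes A: "A \<in> carrier_mat n n" and normal: "A * conj_transpose A = conj_transpose A * A"
  shows "char_matrix A e * conj_transpose (char_matrix A e) =
    conj_transpose (char_matrix A e) * char_matrix A e"
proof -
  define H where "H = conj_transpose A"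
  have H: "H \<in> carrier_mat n n" using A by (auto simp: H_def)
  \<comment> \<open>The expansion is symmetric under exchanging \<open>(X, a)\<close> with
    \<open>(Y, b)\<close>, apart from the term \<open>X * Y\<close>.\<close>
  have shift: "char_matrix X a * char_matrix Y b
      = X * Y + (- a) \<cdot>\<^sub>m Y + (- b) \<cdot>\<^sub>m X + (a * b) \<cdot>\<^sub>m 1\<^sub>m n"
    if X: "X \<in> carrier_mat n n" and Y: "Y \<in> carrier_mat n n" for X Y :: "complex mat" and a b
  proof -
    have "char_matrix X a * char_matrix Y b
        = (X + (- a) \<cdot>\<^sub>m 1\<^sub>m n) * Y + (X + (- a) \<cdot>\<^sub>m 1\<^sub>m n) * ((- b) \<cdot>\<^sub>m 1\<^sub>m n)"
      using X Y by (simp add: char_matrix_def mult_add_distrib_mat[of _ n n _ n])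
    also have "(X + (- a) \<cdot>\<^sub>m 1\<^sub>m n) * Y = X * Y + (- a) \<cdot>\<^sub>m Y"
      using X Y by (simp add: add_mult_distrib_mat[of _ n n _ _ n] mult_smult_assoc_mat[of _ n n _ n])
    also have "(X + (- a) \<cdot>\<^sub>m 1\<^sub>m n) * ((- b) \<cdot>\<^sub>m 1\<^sub>m n) = (- b) \<cdot>\<^sub>m (X + (- a) \<cdot>\<^sub>m 1\<^sub>m n)"
      using X by (simp add: mult_smult_distrib[of _ n n _ n])
    finally show ?thesis
      using X Y by (intro eq_matI) (auto simp: algebra_simps)
  qed
  show ?thesis
    unfolding conj_transpose_char_matrix[OF A] H_def[symmetric] shift[OF A H] shift[OF H A]
    unfolding H_def normal
    using A by (intro eq_matI) (auto simp: algebra_simps)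
qed

text \<open>The eigenspace is the kernel of the normal matrix \<open>A - e\<close>, whose adjoint is
  the adjoint of \<open>A\<close> shifted by \<open>cnj e\<close>.\<close>

lemma normal_conj_transpose_eigenvector:
  assumes A: "A \<in> carrier_mat n n" and normal: "A * conj_transpose A = conj_transpose A * A"
    and v: "v \<in> carrier_vec n" and Av: "A *\<^sub>v v = e \<cdot>\<^sub>v v"
  shows "conj_transpose A *\<^sub>v v = cnj e \<cdot>\<^sub>v v"
proof -
  have char: "char_matrix X a *\<^sub>v v = 0\<^sub>v n \<longleftrightarrow> X *\<^sub>v v = a \<cdot>\<^sub>v v"
    if X: "X \<in> carrier_mat n n" for X a
  proof -
    have "char_matrix X a *\<^sub>v v = X *\<^sub>v v + (- a) \<cdot>\<^sub>v v"
      using X v unfolding char_matrix_def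
      by (subst add_mult_distrib_mat_vec[of _ n n]) (auto intro!: eq_vecI)
    then show ?thesis
      using X v by (auto simp: vec_eq_iff)
  qed
  have "char_matrix A e *\<^sub>v v = 0\<^sub>v n" using char[OF A] Av by blast
  then have "conj_transpose (char_matrix A e) *\<^sub>v v = 0\<^sub>v n"
    using A v by (intro normal_kernel_conj_transpose normal_char_matrix normal) auto
  then show ?thesis
    unfolding conj_transpose_char_matrix[OF A] using A by (subst (asm) char) auto
qed

section \<open>The Jordan form of a normal matrix\<close>

lemma normal_jordan_block_size:
  assumes A: "A \<in> carrier_mat n n" and normal: "A * conj_transpose A = conj_transpose A * A"
    and jnf: "jordan_nf A n_as" and mem: "(m, e) \<in> set n_as"
  shows "m \<le> 1"
proof -
  let ?C = "char_matrix A e"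
  have C: "?C \<in> carrier_mat n n" using A by simp
  have "?C ^\<^sub>m 2 = ?C * ?C" using C by (simp add: numeral_2_eq_2)
  then have "mat_kernel (?C ^\<^sub>m 2) = mat_kernel ?C"
    using C normal_kernel_square[OF C normal_char_matrix[OF A normal]]
    by (auto simp: mat_kernel_def)
  \<comment> \<open>The dimension of the kernel of \<open>(A - e) ^ k\<close> is the sum of
    \<open>min k n\<close> over the sizes \<open>n\<close> of the blocks for \<open>e\<close>;
    passing from \<open>k = 1\<close> to \<open>k = 2\<close> thus counts the blocks of size at
    least 2.\<close>
  then have "dim_gen_eigenspace A e 2 = dim_gen_eigenspace A e 1"
    using C by (simp add: dim_gen_eigenspace_def kernel_dim_def)
  then have eq: "(\<Sum>n\<leftarrow>ns. min 2 n) = (\<Sum>n\<leftarrow>ns. min 1 n)"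
    if "ns = map fst [(n, e')\<leftarrow>n_as . e' = e]" for ns
    unfolding dim_gen_eigenspace[OF jnf] that .
  \<comment> \<open>The summands on the left dominate those on the right, so equal sums force
    \<open>min 2 n = min 1 n\<close> for every block.\<close>
  have "\<forall>n\<in>set ns. n \<le> 1" if "(\<Sum>n\<leftarrow>ns. min 2 n) = (\<Sum>n\<leftarrow>ns. min 1 n)" for ns :: "nat list"
    using that
  proof (induction ns)
    case (Cons n ns)
    have "(\<Sum>n\<leftarrow>ns. min 1 n) \<le> (\<Sum>n\<leftarrow>ns. min 2 n)"
      by (rule sum_list_mono) auto
    with Cons.prems have "min 2 n = min 1 n" "(\<Sum>n\<leftarrow>ns. min 2 n) = (\<Sum>n\<leftarrow>ns. min 1 n)"
      by simp_all
    with Cons.IH show ?case by simp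
  qed simp
  from this[OF eq[OF refl]] mem show ?thesis by force
qed

text \<open>Off the diagonal, a Jordan block is nonzero only on its superdiagonal, which is empty
  for size at most 1.\<close>

lemma diagonal_jordan_matrix:
  assumes "\<And>m e. (m, e) \<in> set n_as \<Longrightarrow> m \<le> 1"
  shows "diagonal_mat (jordan_matrix n_as)"
  using assms
proof (induction n_as)
  case Nil
  then show ?case by (simp add: diagonal_mat_def)
next
  case (Cons me n_as)
  obtain m e where me: "me = (m, e)" by force
  from Cons have "diagonal_mat (jordan_matrix n_as)" "m \<le> 1" by (auto simp: me)
  then show ?case
    by (auto simp: me jordan_matrix_Cons diagonal_mat_def)
qed

text \<open>The Jordan basis consists of eigenvectors of \<open>A\<close>. These are eigenvectors of
  the adjoint too, so the same basis diagonalizes both.\<close>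

lemma normal_diagonalizable:
  assumes A: "A \<in> carrier_mat n n" and normal: "A * conj_transpose A = conj_transpose A * A"
  obtains U V where "U \<in> carrier_mat n n" "V \<in> carrier_mat n n" "U * V = 1\<^sub>m n" "V * U = 1\<^sub>m n"
    "diagonal_mat (U * A * V)" "diagonal_mat (U * conj_transpose A * V)"
proof -
  let ?H = "conj_transpose A"
  \<comment> \<open>Over the complex numbers the characteristic polynomial splits, which provides a
    Jordan form.\<close>
  obtain n_as where jnf: "jordan_nf A n_as"
    using char_poly_factorized[OF A] jordan_nf_exists[OF A] by blast
  define D where "D = jordan_matrix n_as"
  have diag: "diagonal_mat D"
    unfolding D_def using normal_jordan_block_size[OF A normal jnf] by (rule diagonal_jordan_matrix)
  from jnf obtain V U where sim: "similar_mat_wit A D V U"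
    unfolding jordan_nf_def similar_mat_def D_def by blast
  note * = similar_mat_witD2[OF A sim]
  have U: "U \<in> carrier_mat n n" and V: "V \<in> carrier_mat n n" and D: "D \<in> carrier_mat n n"
    and UV: "U * V = 1\<^sub>m n" and VU: "V * U = 1\<^sub>m n" and AD: "A = V * D * U"
    using * by auto
  have AV: "A * V = V * D"
    unfolding AD using U V D UV by (simp add: assoc_mult_mat[of _ n n _ n _ n])
  have "U * A * V = D"
    using A U V D UV AV by (simp add: assoc_mult_mat[of _ n n _ n _ n])
      (simp flip: assoc_mult_mat[of _ n n _ n _ n])
  moreover have "diagonal_mat (U * ?H * V)"
    unfolding diagonal_mat_def
  proof (intro allI impI)
    fix i j assume "i < dim_row (U * ?H * V)" "j < dim_col (U * ?H * V)" and ij: "i \<noteq> j"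
    with U V have i: "i < n" and j: "j < n" by auto
    \<comment> \<open>Comparing the columns of \<open>A * V = V * D\<close> shows that column
      \<open>j\<close> of \<open>V\<close> is an eigenvector for the \<open>j\<close>-th diagonal
      entry of \<open>D\<close>.\<close>
    have "A *\<^sub>v col V j = col (V * D) j"
      using A V D j by (simp flip: AV)
    also have "\<dots> = D $$ (j, j) \<cdot>\<^sub>v col V j"
    proof (rule eq_vecI)
      fix l assume "l < dim_vec (D $$ (j, j) \<cdot>\<^sub>v col V j)"
      with V have l: "l < n" by simp
      have "col (V * D) j $ l = (\<Sum>m\<in>{0..<n}. V $$ (l, m) * D $$ (m, j))"
        using V D j l by (simp add: scalar_prod_def)
      also have "\<dots> = (\<Sum>m\<in>{0..<n}. if m = j then V $$ (l, m) * D $$ (j, j) else 0)"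
        using diag D j by (intro sum.cong) (auto simp: diagonal_mat_def)
      finally show "col (V * D) j $ l = (D $$ (j, j) \<cdot>\<^sub>v col V j) $ l"
        using V j l by simp
    qed (use V in auto)
    finally have "?H *\<^sub>v col V j = cnj (D $$ (j, j)) \<cdot>\<^sub>v col V j"
      using V j by (intro normal_conj_transpose_eigenvector[OF A normal]) auto
    then have "(U * (?H * V)) $$ (i, j) = cnj (D $$ (j, j)) * (U * V) $$ (i, j)"
      using A U V i j by simp
    then show "(U * ?H * V) $$ (i, j) = 0"
      using A U V i j ij UV by (simp add: assoc_mult_mat[of _ n n _ n _ n])
  qed
  ultimately show ?thesis
    using that[OF U V UV VU] diag by simp
qed

section \<open>Simultaneous diagonalization\<close>

text \<open>\<open>inverts_mat\<close> leaves the dimensions of \<open>V\<close> implicit: its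
  columns are read off from \<open>U * V\<close>, its rows from \<open>V * U\<close>.\<close>

lemma inverts_matD:
  fixes U V :: "'a :: semiring_1 mat"
  assumes U: "U \<in> carrier_mat n n" and V: "inverts_mat U V" "inverts_mat V U"
  shows "V \<in> carrier_mat n n" "U * V = 1\<^sub>m n" "V * U = 1\<^sub>m n"
proof -
  show UV: "U * V = 1\<^sub>m n" using U V by (auto simp: inverts_mat_def)
  have VU: "V * U = 1\<^sub>m (dim_row V)" using V by (simp add: inverts_mat_def)
  have "dim_col V = n" using arg_cong[OF UV, of dim_col] by simp
  moreover have row: "dim_row V = n" using arg_cong[OF VU, of dim_col] U by simp
  ultimately show "V \<in> carrier_mat n n" by blast
  show "V * U = 1\<^sub>m n" using VU row by simp
qed

text \<open>Uniqueness of the inverse replaces the existential witness by a fixed \<open>V\<close>,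
  which can then serve several matrices at once.\<close>

lemma diagonalizes_iff:
  assumes U: "U \<in> carrier_mat n n" and V: "V \<in> carrier_mat n n"
    and UV: "U * V = 1\<^sub>m n" and VU: "V * U = 1\<^sub>m n"
  shows "diagonalizes U A \<longleftrightarrow> diagonal_mat (U * A * V)"
proof -
  have "W = V" if W: "inverts_mat U W" "inverts_mat W U" for W
  proof -
    note inv = inverts_matD[OF U W]
    have "W = V * U * W" using VU inv by simp
    also have "\<dots> = V * (U * W)" using U V inv by (intro assoc_mult_mat) auto
    also have "\<dots> = V" using inv V by simp
    finally show ?thesis .
  qed
  moreover have "inverts_mat U V" "inverts_mat V U"
    using assms by (auto simp: inverts_mat_def)
  ultimately show ?thesis unfolding diagonalizes_def by metis
qed

section \<open>Diagonal matrices, similarity and commutation\<close>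

lemma diagonal_mat_mult_index:
  fixes D E :: "'a :: semiring_0 mat"
  assumes D: "D \<in> carrier_mat n n" "diagonal_mat D" and E: "E \<in> carrier_mat n n"
    and "i < n" "j < n"
  shows "(D * E) $$ (i, j) = D $$ (i, i) * E $$ (i, j)"
proof -
  have "(D * E) $$ (i, j) = (\<Sum>m\<in>{0..<n}. D $$ (i, m) * E $$ (m, j))"
    using assms by (simp add: scalar_prod_def)
  also have "\<dots> = (\<Sum>m\<in>{0..<n}. if m = i then D $$ (i, i) * E $$ (i, j) else 0)"
    using assms by (intro sum.cong) (auto simp: diagonal_mat_def)
  finally show ?thesis using assms by simp
qed

lemma diagonal_mat_mult:
  fixes D E :: "'a :: semiring_0 mat"
  assumes "D \<in> carrier_mat n n" "diagonal_mat D" "E \<in> carrier_mat n n" "diagonal_mat E"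
  shows "diagonal_mat (D * E)"
  using assms unfolding diagonal_mat_def[of "D * E"]
  by (auto simp: diagonal_mat_mult_index simp del: index_mult_mat(1)) (auto simp: diagonal_mat_def)

lemma diagonal_mat_mult_commute:
  fixes D E :: "'a :: comm_semiring_0 mat"
  assumes "D \<in> carrier_mat n n" "diagonal_mat D" "E \<in> carrier_mat n n" "diagonal_mat E"
  shows "D * E = E * D"
proof (rule eq_matI)
  fix i j assume "i < dim_row (E * D)" "j < dim_col (E * D)"
  with assms have ij: "i < n" "j < n" by auto
  show "(D * E) $$ (i, j) = (E * D) $$ (i, j)"
    using assms ij by (cases "i = j")
      (auto simp: diagonal_mat_mult_index mult.commute simp del: index_mult_mat(1), simp add: diagonal_mat_def)
qed (use assms in auto)

lemma similarity_mult:
  fixes U V A B :: "'a :: semiring_1 mat"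
  assumes "U \<in> carrier_mat n n" "V \<in> carrier_mat n n" "V * U = 1\<^sub>m n"
    and "A \<in> carrier_mat n n" "B \<in> carrier_mat n n"
  shows "U * (A * B) * V = (U * A * V) * (U * B * V)"
proof -
  have "(U * A * V) * (U * B * V) = U * A * ((V * U) * (B * V))"
    using assms(1,2,4,5) by (simp add: assoc_mult_mat[of _ n n _ n _ n])
  also have "\<dots> = U * (A * B) * V"
    using assms by (simp add: assoc_mult_mat[of _ n n _ n _ n])
  finally show ?thesis ..
qed

lemma similarity_inj:
  fixes U V A B :: "'a :: semiring_1 mat"
  assumes "U \<in> carrier_mat n n" "V \<in> carrier_mat n n" "V * U = 1\<^sub>m n"
    and "A \<in> carrier_mat n n" "B \<in> carrier_mat n n" and eq: "U * A * V = U * B * V"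
  shows "A = B"
proof -
  have undo: "V * (U * X * V) * U = X" if "X \<in> carrier_mat n n" for X
  proof -
    have "V * (U * X * V) * U = (V * U) * X * (V * U)"
      using assms(1,2) that by (simp add: assoc_mult_mat[of _ n n _ n _ n])
    then show ?thesis using assms(3) that by simp
  qed
  from undo[of A] undo[of B] show ?thesis using assms by simp
qed

text \<open>Diagonal matrices commute, and conjugation by \<open>U\<close> is multiplicative and
  injective, so the commutation can be pulled back.\<close>

lemma diagonalizes_commute:
  assumes U: "U \<in> carrier_mat n n" and A: "A \<in> carrier_mat n n" and B: "B \<in> carrier_mat n n"
    and dA: "diagonalizes U A" and dB: "diagonalizes U B"
  shows "A * B = B * A"
proof -
  from dA obtain V where V: "inverts_mat U V" "inverts_mat V U" "diagonal_mat (U * A * V)"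
    unfolding diagonalizes_def by blast
  note Vc = inverts_matD(1)[OF U V(1,2)] and UV = inverts_matD(2)[OF U V(1,2)]
    and VU = inverts_matD(3)[OF U V(1,2)]
  have "diagonal_mat (U * B * V)"
    using dB diagonalizes_iff[OF U Vc UV VU] by blast
  then have "U * (A * B) * V = U * (B * A) * V"
    unfolding similarity_mult[OF U Vc VU A B] similarity_mult[OF U Vc VU B A]
    using V(3) U Vc A B by (intro diagonal_mat_mult_commute[of _ n]) auto
  then show ?thesis
    by (rule similarity_inj[OF U Vc VU mult_carrier_mat[OF A B] mult_carrier_mat[OF B A]])
qed

section \<open>Real normal matrices viewed over the complex numbers\<close>

lemma conj_transpose_of_real:
  "conj_transpose (map_mat complex_of_real A) = map_mat complex_of_real (transpose_mat A)"
  by (intro eq_matI) auto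

lemma normal_mat_of_real:
  assumes A: "A \<in> carrier_mat n n" and normal: "normal_mat A"
  defines "C \<equiv> map_mat complex_of_real A"
  shows "C * conj_transpose C = conj_transpose C * C"
proof -
  have "C * conj_transpose C = map_mat complex_of_real (A * transpose_mat A)"
    "conj_transpose C * C = map_mat complex_of_real (transpose_mat A * A)"
    using A unfolding C_def conj_transpose_of_real by (auto intro!: of_real_hom.mat_hom_mult[symmetric])
  then show ?thesis using normal by (simp add: normal_mat_def)
qed

text \<open>The set has the shape of the three expectations, with \<open>a = p\<close>,
  \<open>b = p\<^sup>2\<close> and \<open>c = p - p\<^sup>2\<close>. All members are polynomial
  expressions in \<open>A\<close> and its transpose, and conjugation by \<open>U\<close> respects
  sums, products and scalar factors.\<close>

lemma normal_real_simultaneously_diagonalizable: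
  assumes A: "A \<in> carrier_mat n n" and normal: "normal_mat A"
  shows "simultaneously_diagonalizable n
    {a \<cdot>\<^sub>m A, a \<cdot>\<^sub>m transpose_mat A, b \<cdot>\<^sub>m (transpose_mat A * A) + c \<cdot>\<^sub>m (A + transpose_mat A)}"
proof -
  let ?c = "map_mat complex_of_real"
  define C where "C = ?c A"
  define H where "H = ?c (transpose_mat A)"
  have C: "C \<in> carrier_mat n n" and H: "H \<in> carrier_mat n n"
    using A by (auto simp: C_def H_def)
  have CH: "conj_transpose C = H"
    unfolding C_def H_def by (rule conj_transpose_of_real)
  have HC: "C * conj_transpose C = conj_transpose C * C"
    unfolding C_def by (rule normal_mat_of_real[OF A normal])
  obtain U V where U: "U \<in> carrier_mat n n" and V: "V \<in> carrier_mat n n"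
    and UV: "U * V = 1\<^sub>m n" and VU: "V * U = 1\<^sub>m n"
    and dC: "diagonal_mat (U * C * V)" and dH: "diagonal_mat (U * H * V)"
    using normal_diagonalizable[OF C HC] unfolding CH by metis
  have smult: "U * (x \<cdot>\<^sub>m X) * V = x \<cdot>\<^sub>m (U * X * V)" if "X \<in> carrier_mat n n" for x X
    using that U V by (simp add: mult_smult_distrib[of _ n n _ n] mult_smult_assoc_mat[of _ n n _ n])
  have add: "U * (X + Y) * V = U * X * V + U * Y * V"
    if "X \<in> carrier_mat n n" "Y \<in> carrier_mat n n" for X Y
    using that U V by (simp add: mult_add_distrib_mat[of _ n n _ n] add_mult_distrib_mat[of _ n n _ _ n])
  have d_smult: "diagonal_mat (x \<cdot>\<^sub>m X)" if "diagonal_mat X" for x and X :: "complex mat"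
    using that by (auto simp: diagonal_mat_def)
  have d_add: "diagonal_mat (X + Y)"
    if "diagonal_mat X" "diagonal_mat Y" "X \<in> carrier_mat n n" "Y \<in> carrier_mat n n"
    for X Y :: "complex mat"
    using that by (auto simp: diagonal_mat_def)
  have HC_prod: "H * C = ?c (transpose_mat A * A)"
    using A unfolding C_def H_def by (auto intro!: of_real_hom.mat_hom_mult[symmetric])
  have "?c (a \<cdot>\<^sub>m A) = complex_of_real a \<cdot>\<^sub>m C"
    by (auto simp: C_def)
  then have 1: "diagonal_mat (U * ?c (a \<cdot>\<^sub>m A) * V)"
    using smult[OF C] d_smult[OF dC] by simp
  have "?c (a \<cdot>\<^sub>m transpose_mat A) = complex_of_real a \<cdot>\<^sub>m H"
    by (auto simp: H_def)
  then have 2: "diagonal_mat (U * ?c (a \<cdot>\<^sub>m transpose_mat A) * V)"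
    using smult[OF H] d_smult[OF dH] by simp
  have carr: "U * C * V \<in> carrier_mat n n" "U * H * V \<in> carrier_mat n n"
    "U * (H * C) * V \<in> carrier_mat n n" "H * C \<in> carrier_mat n n" "C + H \<in> carrier_mat n n"
    using U V C H by auto
  have dHC: "diagonal_mat (U * (H * C) * V)"
    unfolding similarity_mult[OF U V VU H C] by (rule diagonal_mat_mult[OF carr(2) dH carr(1) dC])
  have "?c (b \<cdot>\<^sub>m (transpose_mat A * A) + c \<cdot>\<^sub>m (A + transpose_mat A))
      = complex_of_real b \<cdot>\<^sub>m (H * C) + complex_of_real c \<cdot>\<^sub>m (C + H)"
    unfolding HC_prod using A by (intro eq_matI) (auto simp: C_def H_def)
  then have "U * ?c (b \<cdot>\<^sub>m (transpose_mat A * A) + c \<cdot>\<^sub>m (A + transpose_mat A)) * V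
      = complex_of_real b \<cdot>\<^sub>m (U * (H * C) * V)
        + complex_of_real c \<cdot>\<^sub>m (U * C * V + U * H * V)"
    using smult[OF carr(4)] smult[OF carr(5)] add[OF C H] carr by (simp add: add)
  then have 3: "diagonal_mat (U * ?c (b \<cdot>\<^sub>m (transpose_mat A * A) + c \<cdot>\<^sub>m (A + transpose_mat A)) * V)"
    using carr by (auto intro!: d_add d_smult dHC dC dH)
  show ?thesis
    unfolding simultaneously_diagonalizable_def
    using U 1 2 3 by (intro bexI[of _ U]) (auto simp: diagonalizes_iff[OF U V UV VU])
qed

text \<open>Commutation is obtained over the complex numbers, where \<open>U\<close> lives, and
  descends because the embedding of the reals is injective.\<close>

lemma normal_mat_if_simultaneously_diagonalizable:
  assumes A: "A \<in> carrier_mat n n"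
    and "simultaneously_diagonalizable n S" "A \<in> S" "transpose_mat A \<in> S"
  shows "normal_mat A"
proof -
  let ?c = "map_mat complex_of_real"
  obtain U where U: "U \<in> carrier_mat n n" "diagonalizes U (?c A)" "diagonalizes U (?c (transpose_mat A))"
    using assms by (auto simp: simultaneously_diagonalizable_def)
  then have "?c A * ?c (transpose_mat A) = ?c (transpose_mat A) * ?c A"
    using A by (intro diagonalizes_commute[of U n]) auto
  then have "?c (A * transpose_mat A) = ?c (transpose_mat A * A)"
    using A by (simp add: of_real_hom.mat_hom_mult[of _ n n _ n])
  then show ?thesis unfolding normal_mat_def by (rule of_real_hom.mat_hom_inj)
qed

lemma normal_mat_smult_iff:
  assumes "A \<in> carrier_mat n n" "c \<noteq> 0"
  shows "normal_mat (c \<cdot>\<^sub>m A) \<longleftrightarrow> normal_mat A"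
proof -
  have "(c \<cdot>\<^sub>m A) * transpose_mat (c \<cdot>\<^sub>m A) = (c * c) \<cdot>\<^sub>m (A * transpose_mat A)"
    "transpose_mat (c \<cdot>\<^sub>m A) * (c \<cdot>\<^sub>m A) = (c * c) \<cdot>\<^sub>m (transpose_mat A * A)"
    using assms(1) by (auto intro!: eq_matI)
  moreover have "d \<cdot>\<^sub>m X = d \<cdot>\<^sub>m Y \<longleftrightarrow> X = Y" if "d \<noteq> 0" for d and X Y :: "real mat"
    using that by (auto simp: mat_eq_iff)
  ultimately show ?thesis using assms(2) by (simp add: normal_mat_def)
qed

text \<open>Zero row sums place the all-ones vector in the kernel of \<open>A\<close>; normality
  places it in the kernel of the adjoint, which is the transpose for real \<open>A\<close>.\<close>

lemma normal_mat_col_sum: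
  assumes A: "A \<in> carrier_mat n n" and normal: "normal_mat A"
    and rows: "\<And>i. i < n \<Longrightarrow> (\<Sum>j<n. A $$ (i, j)) = 0" and j: "j < n"
  shows "(\<Sum>i<n. A $$ (i, j)) = 0"
proof -
  let ?c = "map_mat complex_of_real"
  define C where "C = ?c A"
  have C: "C \<in> carrier_mat n n" using A by (auto simp: C_def)
  have CH: "conj_transpose C = ?c (transpose_mat A)"
    unfolding C_def by (rule conj_transpose_of_real)
  have HC: "C * conj_transpose C = conj_transpose C * C"
    unfolding C_def by (rule normal_mat_of_real[OF A normal])
  define v where "v = vec n (\<lambda>_. 1 :: complex)"
  have "C *\<^sub>v v = 0\<^sub>v n"
  proof (rule eq_vecI)
    fix i assume "i < dim_vec (0\<^sub>v n :: complex vec)"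
    then have i: "i < n" by simp
    have "(C *\<^sub>v v) $ i = complex_of_real (\<Sum>j<n. A $$ (i, j))"
      using A i by (simp add: C_def v_def scalar_prod_def atLeast0LessThan)
    then show "(C *\<^sub>v v) $ i = 0\<^sub>v n $ i" using rows i by simp
  qed (use C in simp)
  then have "(conj_transpose C *\<^sub>v v) $ j = 0"
    using j by (subst normal_kernel_conj_transpose[OF C HC]) (auto simp: v_def)
  moreover have "(conj_transpose C *\<^sub>v v) $ j = complex_of_real (\<Sum>i<n. A $$ (i, j))"
    unfolding CH using A j by (simp add: v_def scalar_prod_def atLeast0LessThan)
  ultimately show ?thesis by (simp only: of_real_eq_0_iff)
qed

section \<open>Moments of the random Laplacian\<close>

text \<open>The signed incidence vector of the edge from \<open>n\<close> to \<open>m\<close>: the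
  unit vector at \<open>m\<close> minus the unit vector at \<open>n\<close>.\<close>

definition incidence :: "nat \<Rightarrow> nat \<Rightarrow> nat \<Rightarrow> real" where
  "incidence m n i = of_bool (i = m) - of_bool (i = n)"

section \<open>Laplacians as sums over incoming edges\<close>

context
  fixes G :: "nat pair_pre_digraph" and N :: nat
  assumes digraph: "pair_digraph G" and verts: "pverts G = {..<N}"
begin

interpretation pair_digraph G by (rule digraph)

lemma in_nbrs_conv_arc: "n \<in> in_nbrs G m \<longleftrightarrow> (n, m) \<in> parcs G"
  by (auto simp: in_nbrs_def dest: in_arcsD1)

lemma in_nbrs_vertices: "in_nbrs G m \<subseteq> {..<N} - {m}"
  using verts by (auto simp: in_nbrs_def dest: no_loops')

lemma finite_in_nbrs [simp]: "finite (in_nbrs G m)"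
  by (rule finite_subset[OF in_nbrs_vertices]) simp

text \<open>On the diagonal every coefficient is 1, as there are no self-loops; off the diagonal
  only \<open>n = i\<close> contributes, with coefficient -1.\<close>

lemma random_laplacian_incidence:
  assumes "m < N" "i < N"
  shows "random_laplacian N G \<alpha> k \<omega> $$ (m, i) = (\<Sum>n\<in>in_nbrs G m. incidence m n i * \<alpha> m n k \<omega>)"
proof (cases "i = m")
  case True
  then show ?thesis
    using assms in_nbrs_vertices[of m]
    by (auto simp: random_laplacian_def incidence_def intro!: sum.cong)
next
  case False
  then have "(\<Sum>n\<in>in_nbrs G m. incidence m n i * \<alpha> m n k \<omega>)
      = (\<Sum>n\<in>in_nbrs G m. if n = i then - \<alpha> m i k \<omega> else 0)"
    by (intro sum.cong) (auto simp: incidence_def)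
  then show ?thesis
    using assms False by (simp add: random_laplacian_def)
qed

lemma laplacian_incidence:
  assumes "m < N" "i < N"
  shows "laplacian N G $$ (m, i) = (\<Sum>n\<in>in_nbrs G m. incidence m n i)"
proof -
  \<comment> \<open>The nominal Laplacian is the random one with all packets transmitted; the time
    \<open>0\<close> and the sample point \<open>()\<close> are arbitrary.\<close>
  have "laplacian N G $$ (m, i) = random_laplacian N G (\<lambda>_ _ _ _. 1) 0 () $$ (m, i)"
    using assms by (auto simp: laplacian_def random_laplacian_def)
  then show ?thesis
    using random_laplacian_incidence[OF assms, of "\<lambda>_ _ _ _. 1" 0 "()"] by simp
qed

lemma laplacian_row_sum:
  assumes "m < N"
  shows "(\<Sum>i<N. laplacian N G $$ (m, i)) = 0"
proof -
  have "(\<Sum>i<N. laplacian N G $$ (m, i)) = (\<Sum>n\<in>in_nbrs G m. \<Sum>i<N. incidence m n i)"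
    using assms by (simp add: laplacian_incidence sum.swap[of _ "in_nbrs G m"])
  also have "\<dots> = 0"
  proof (rule sum.neutral, rule ballI)
    fix n assume "n \<in> in_nbrs G m"
    then have "n < N" using in_nbrs_vertices[of m] by auto
    with assms show "(\<Sum>i<N. incidence m n i) = 0"
      by (simp add: incidence_def sum_subtractf of_bool_def del: sum_of_bool_eq sum.If_cases)
  qed
  finally show ?thesis .
qed

text \<open>Without \<open>cols\<close>, the right-hand side would be reduced by the diagonal matrix
  of the column sums of the Laplacian.\<close>

lemma sum_incidence_products:
  assumes cols: "\<And>j. j < N \<Longrightarrow> (\<Sum>m<N. laplacian N G $$ (m, j)) = 0" and ij: "i < N" "j < N"
  shows "(\<Sum>m<N. \<Sum>n\<in>in_nbrs G m. incidence m n i * incidence m n j)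
    = laplacian N G $$ (i, j) + laplacian N G $$ (j, i)"
proof -
  \<comment> \<open>Restricting the sum over all edges to those that end in \<open>a\<close>
    recovers row \<open>a\<close>.\<close>
  have row: "laplacian N G $$ (a, b) = (\<Sum>m<N. \<Sum>n\<in>in_nbrs G m. of_bool (a = m) * incidence m n b)"
    if "a < N" "b < N" for a b
  proof -
    have "laplacian N G $$ (a, b) = (\<Sum>m<N. if m = a then \<Sum>n\<in>in_nbrs G m. incidence m n b else 0)"
      using that by (simp add: laplacian_incidence)
    also have "\<dots> = (\<Sum>m<N. \<Sum>n\<in>in_nbrs G m. of_bool (a = m) * incidence m n b)"
      by (intro sum.cong) auto
    finally show ?thesis .
  qed
  \<comment> \<open>With \<open>b\<close> the incidence vector of the edge, the termwise identity is
    \<open>b i * b j = [i = m] * b j + [j = m] * b i - [i = j] * b j\<close>. The three terms sum to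
    an entry of \<open>L\<close>, one of its transpose, and a column sum.\<close>
  have "(\<Sum>m<N. \<Sum>n\<in>in_nbrs G m. incidence m n i * incidence m n j)
      = (\<Sum>m<N. \<Sum>n\<in>in_nbrs G m. of_bool (i = m) * incidence m n j
          + of_bool (j = m) * incidence m n i - of_bool (i = j) * incidence m n j)"
    by (intro sum.cong refl) (auto simp: incidence_def)
  also have "\<dots> = laplacian N G $$ (i, j) + laplacian N G $$ (j, i)
        - of_bool (i = j) * (\<Sum>m<N. \<Sum>n\<in>in_nbrs G m. incidence m n j)"
    unfolding row[OF ij] row[OF ij(2,1)] sum_distrib_left sum.distrib sum_subtractf ..
  also have "(\<Sum>m<N. \<Sum>n\<in>in_nbrs G m. incidence m n j) = (\<Sum>m<N. laplacian N G $$ (m, j))"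
    using ij by (simp add: laplacian_incidence)
  finally show ?thesis using cols ij by simp
qed

end

section \<open>First and second moments of the transmission variables\<close>

lemma (in bernoulli_packet_loss) integrable_transmission:
  assumes "(j, i) \<in> parcs G"
  shows "integrable M (\<alpha> i j k)"
proof (rule integrable_const_bound[of _ 1])
  show "AE \<omega> in M. norm (\<alpha> i j k \<omega>) \<le> 1"
    using binary[OF assms, of _ k] by (intro AE_I2) fastforce
  show "random_variable borel (\<alpha> i j k)"
    using stationary[OF assms] by (simp add: stationary_process_def)
qed

lemma (in bernoulli_packet_loss) expectation_transmission:
  assumes "(j, i) \<in> parcs G"
  shows "expectation (\<alpha> i j k) = p"
proof -
  have [measurable]: "random_variable borel (\<alpha> i j k)"
    using stationary[OF assms] by (simp add: stationary_process_def)
  \<comment> \<open>A variable with values 0 and 1 is the indicator of the event that it equals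
    1.\<close>
  have "expectation (\<alpha> i j k) = expectation (indicator {\<omega> \<in> space M. \<alpha> i j k \<omega> = 1})"
    using binary[OF assms] by (intro Bochner_Integration.integral_cong) (force simp: indicator_def)+
  then show ?thesis
    using prob_transmitted[OF assms] by simp
qed

text \<open>For one edge, the square of a binary variable is the variable itself, with mean
  \<open>p\<close>; for two edges into \<open>m\<close>, independence gives
  \<open>p\<^sup>2\<close>. The formula covers both cases.\<close>

lemma (in bernoulli_packet_loss)
  assumes "(n, m) \<in> parcs G" "(n', m) \<in> parcs G" "n \<noteq> m"
  shows integrable_transmission_mult: "integrable M (\<lambda>\<omega>. \<alpha> m n k \<omega> * \<alpha> m n' k \<omega>)"
    and expectation_transmission_mult:
      "expectation (\<lambda>\<omega>. \<alpha> m n k \<omega> * \<alpha> m n' k \<omega>) = p\<^sup>2 + of_bool (n = n') * (p - p\<^sup>2)"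
proof -
  have "integrable M (\<lambda>\<omega>. \<alpha> m n k \<omega> * \<alpha> m n' k \<omega>) \<and>
    expectation (\<lambda>\<omega>. \<alpha> m n k \<omega> * \<alpha> m n' k \<omega>) = p\<^sup>2 + of_bool (n = n') * (p - p\<^sup>2)"
  proof (cases "n = n'")
    case True
    have *: "\<alpha> m n k \<omega> * \<alpha> m n' k \<omega> = \<alpha> m n k \<omega>" if "\<omega> \<in> space M" for \<omega>
      using binary[OF assms(1) that, of k] True by auto
    have "integrable M (\<lambda>\<omega>. \<alpha> m n k \<omega> * \<alpha> m n' k \<omega>) \<longleftrightarrow> integrable M (\<alpha> m n k)"
      using * by (intro Bochner_Integration.integrable_cong) auto
    moreover have "expectation (\<lambda>\<omega>. \<alpha> m n k \<omega> * \<alpha> m n' k \<omega>) = expectation (\<alpha> m n k)"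
      using * by (intro Bochner_Integration.integral_cong) auto
    ultimately show ?thesis
      using True integrable_transmission[OF assms(1)] expectation_transmission[OF assms(1)] by simp
  next
    case False
    \<comment> \<open>Both edges end in \<open>m\<close> and \<open>n \<noteq> m\<close>, so neither
      is the reverse of the other, and the exception in the independence assumption does not
      arise.\<close>
    then have "indep_var borel (\<alpha> m n k) borel (\<alpha> m n' k)"
      using assms by (intro independent) auto
    then show ?thesis
      using False assms(1,2) indep_var_lebesgue_integral[of "\<alpha> m n k" "\<alpha> m n' k"]
        indep_var_integrable[of "\<alpha> m n k" "\<alpha> m n' k"]
      by (simp add: integrable_transmission expectation_transmission power2_eq_square)
  qed
  then show "integrable M (\<lambda>\<omega>. \<alpha> m n k \<omega> * \<alpha> m n' k \<omega>)"
    "expectation (\<lambda>\<omega>. \<alpha> m n k \<omega> * \<alpha> m n' k \<omega>) = p\<^sup>2 + of_bool (n = n') * (p - p\<^sup>2)"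
    by auto
qed

section \<open>Expectations of the random matrices\<close>

context
  fixes G :: "nat pair_pre_digraph" and N :: nat and M :: "'a measure" and p \<alpha>
  assumes digraph: "pair_digraph G" and verts: "pverts G = {..<N}"
    and loss: "bernoulli_packet_loss M G p \<alpha>"
begin

interpretation bernoulli_packet_loss M G p \<alpha> by (rule loss)

lemmas in_nbrs_facts = in_nbrs_conv_arc[OF digraph verts] in_nbrs_vertices[OF digraph verts]
  finite_in_nbrs[OF digraph verts]

lemma expectation_random_laplacian:
  assumes "i < N" "j < N"
  shows "expectation (\<lambda>\<omega>. random_laplacian N G \<alpha> k \<omega> $$ (i, j)) = p * laplacian N G $$ (i, j)"
  using assms in_nbrs_facts
  by (simp add: random_laplacian_incidence[OF digraph verts] laplacian_incidence[OF digraph verts]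
      integrable_transmission expectation_transmission Bochner_Integration.integral_sum
      sum_distrib_left mult.commute)

lemma mat_expectation_random_laplacian:
  "mat_expectation N M (random_laplacian N G \<alpha> k) = p \<cdot>\<^sub>m laplacian N G"
proof (rule eq_matI)
  show "mat_expectation N M (random_laplacian N G \<alpha> k) $$ (i, j) = (p \<cdot>\<^sub>m laplacian N G) $$ (i, j)"
    if "i < dim_row (p \<cdot>\<^sub>m laplacian N G)" "j < dim_col (p \<cdot>\<^sub>m laplacian N G)" for i j
  proof -
    from that have ij: "i < N" "j < N" by (auto simp: laplacian_def)
    with expectation_random_laplacian[OF ij] that show ?thesis by (simp add: mat_expectation_def)
  qed
qed (auto simp: mat_expectation_def laplacian_def)

lemma mat_expectation_random_laplacian_transpose:
  "mat_expectation N M (\<lambda>\<omega>. transpose_mat (random_laplacian N G \<alpha> k \<omega>))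
    = p \<cdot>\<^sub>m transpose_mat (laplacian N G)"
proof -
  have dims: "dim_row (random_laplacian N G \<alpha> k \<omega>) = N" "dim_col (random_laplacian N G \<alpha> k \<omega>) = N" for \<omega>
    by (simp_all add: random_laplacian_def)
  have "mat_expectation N M (\<lambda>\<omega>. transpose_mat (random_laplacian N G \<alpha> k \<omega>))
      = transpose_mat (mat_expectation N M (random_laplacian N G \<alpha> k))"
    by (rule eq_matI) (auto simp: mat_expectation_def dims)
  then show ?thesis
    unfolding mat_expectation_random_laplacian by (auto intro!: eq_matI)
qed

text \<open>Both entries lie in row \<open>m\<close>, so only edges into \<open>m\<close> meet. The
  factor \<open>p\<^sup>2\<close> common to all pairs rebuilds the product of the nominal entries;
  the excess \<open>p - p\<^sup>2\<close> survives only where an edge meets itself.\<close>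

lemma expectation_random_laplacian_row_mult:
  fixes k :: nat
  assumes m: "m < N" and ij: "i < N" "j < N"
  defines "L \<equiv> random_laplacian N G \<alpha> k"
  shows "integrable M (\<lambda>\<omega>. L \<omega> $$ (m, i) * L \<omega> $$ (m, j))" (is ?int)
    and "expectation (\<lambda>\<omega>. L \<omega> $$ (m, i) * L \<omega> $$ (m, j))
      = p\<^sup>2 * (laplacian N G $$ (m, i) * laplacian N G $$ (m, j))
        + (p - p\<^sup>2) * (\<Sum>n\<in>in_nbrs G m. incidence m n i * incidence m n j)" (is ?eq)
proof -
  let ?S = "in_nbrs G m"
  have L: "L \<omega> $$ (m, i) * L \<omega> $$ (m, j)
      = (\<Sum>n\<in>?S. \<Sum>n'\<in>?S. (incidence m n i * incidence m n' j) * (\<alpha> m n k \<omega> * \<alpha> m n' k \<omega>))" for \<omega>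
    using m ij by (simp add: L_def random_laplacian_incidence[OF digraph verts] sum_product mult_ac)
  have int: "integrable M (\<lambda>\<omega>. \<alpha> m n k \<omega> * \<alpha> m n' k \<omega>)"
    and exp: "expectation (\<lambda>\<omega>. \<alpha> m n k \<omega> * \<alpha> m n' k \<omega>) = p\<^sup>2 + of_bool (n = n') * (p - p\<^sup>2)"
    if "n \<in> ?S" "n' \<in> ?S" for n n'
  proof -
    have "n \<noteq> m" using that in_nbrs_facts(2)[of m] by blast
    with that show "integrable M (\<lambda>\<omega>. \<alpha> m n k \<omega> * \<alpha> m n' k \<omega>)"
      "expectation (\<lambda>\<omega>. \<alpha> m n k \<omega> * \<alpha> m n' k \<omega>) = p\<^sup>2 + of_bool (n = n') * (p - p\<^sup>2)"
      unfolding in_nbrs_facts(1) by (fact integrable_transmission_mult expectation_transmission_mult)+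
  qed
  show ?int unfolding L using int by (intro Bochner_Integration.integrable_sum integrable_mult_right) auto
  have "expectation (\<lambda>\<omega>. L \<omega> $$ (m, i) * L \<omega> $$ (m, j))
      = (\<Sum>n\<in>?S. \<Sum>n'\<in>?S. (incidence m n i * incidence m n' j) * (p\<^sup>2 + of_bool (n = n') * (p - p\<^sup>2)))"
    unfolding L using int exp by (simp add: Bochner_Integration.integral_sum)
  also have "\<dots> = (\<Sum>n\<in>?S. \<Sum>n'\<in>?S. p\<^sup>2 * (incidence m n i * incidence m n' j))
      + (\<Sum>n\<in>?S. \<Sum>n'\<in>?S. if n' = n then (p - p\<^sup>2) * (incidence m n i * incidence m n j) else 0)"
    unfolding sum.distrib[symmetric] by (intro sum.cong refl) (auto simp: algebra_simps)
  also have "\<dots> = p\<^sup>2 * (laplacian N G $$ (m, i) * laplacian N G $$ (m, j))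
        + (p - p\<^sup>2) * (\<Sum>n\<in>?S. incidence m n i * incidence m n j)"
    using m ij in_nbrs_facts(3)
    by (simp add: laplacian_incidence[OF digraph verts] sum_product flip: sum_distrib_left)
  finally show ?eq .
qed

text \<open>An entry of the Gram matrix sums products taken within one row. Summing the excess terms
  over all rows gives the outer squares of all incidence vectors, which \<open>cols\<close> turns
  into \<open>L\<close> plus its transpose.\<close>

lemma mat_expectation_random_laplacian_gram:
  assumes cols: "\<And>j. j < N \<Longrightarrow> (\<Sum>m<N. laplacian N G $$ (m, j)) = 0"
  shows "mat_expectation N M (\<lambda>\<omega>. transpose_mat (random_laplacian N G \<alpha> k \<omega>) * random_laplacian N G \<alpha> k \<omega>)
    = p\<^sup>2 \<cdot>\<^sub>m (transpose_mat (laplacian N G) * laplacian N G)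
      + (p - p\<^sup>2) \<cdot>\<^sub>m (laplacian N G + transpose_mat (laplacian N G))" (is "?E = ?R")
proof (rule eq_matI)
  have carr: "laplacian N G \<in> carrier_mat N N" by (simp add: laplacian_def)
  fix i j assume "i < dim_row ?R" "j < dim_col ?R"
  with carr have ij: "i < N" "j < N" by auto
  have gram: "(transpose_mat A * A) $$ (i, j) = (\<Sum>m<N. A $$ (m, i) * A $$ (m, j))"
    if "A \<in> carrier_mat N N" for A :: "real mat"
    using that ij by (simp add: scalar_prod_def atLeast0LessThan)
  have "random_laplacian N G \<alpha> k \<omega> \<in> carrier_mat N N" for \<omega>
    by (simp add: random_laplacian_def)
  then have "?E $$ (i, j) = (\<Sum>m<N. p\<^sup>2 * (laplacian N G $$ (m, i) * laplacian N G $$ (m, j))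
        + (p - p\<^sup>2) * (\<Sum>n\<in>in_nbrs G m. incidence m n i * incidence m n j))"
    using ij by (simp add: mat_expectation_def gram expectation_random_laplacian_row_mult
        Bochner_Integration.integral_sum del: index_mult_mat)
  also have "\<dots> = p\<^sup>2 * (\<Sum>m<N. laplacian N G $$ (m, i) * laplacian N G $$ (m, j))
      + (p - p\<^sup>2) * (laplacian N G $$ (i, j) + laplacian N G $$ (j, i))"
    using sum_incidence_products[OF digraph verts cols ij]
    by (simp add: sum.distrib flip: sum_distrib_left)
  also have "\<dots> = ?R $$ (i, j)"
    using carr ij by (simp add: gram del: index_mult_mat(1))
  finally show "?E $$ (i, j) = ?R $$ (i, j)" .
qed (auto simp: mat_expectation_def laplacian_def)

end

text \<open>The equivalence is restricted to \<open>p \<noteq> 0\<close>: for \<open>p = 0\<close>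
  the three expectations vanish and are diagonalized by the identity, even if the Laplacian is not
  normal. The second conjunct records the implication that holds for every \<open>p\<close>.\<close>

theorem lemma5:
  fixes N k :: nat
    and G :: "nat pair_pre_digraph"
    and M :: "'a measure"
    and p :: real
    and \<alpha> :: "nat \<Rightarrow> nat \<Rightarrow> nat \<Rightarrow> 'a \<Rightarrow> real"
  assumes "pair_digraph G"
    and "pverts G = {..<N}"
    and "bernoulli_packet_loss M G p \<alpha>"
  shows "let L = random_laplacian N G \<alpha> k;
             diagonalizable = simultaneously_diagonalizable N
               {mat_expectation N M L,
                mat_expectation N M (\<lambda>\<omega>. transpose_mat (L \<omega>)),
                mat_expectation N M (\<lambda>\<omega>. transpose_mat (L \<omega>) * L \<omega>)};
             normal = normal_mat (laplacian N G)
         in (p \<noteq> 0 \<longrightarrow> (diagonalizable \<longleftrightarrow> normal)) \<and> (normal \<longrightarrow> diagonalizable)"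
proof -
  let ?L = "laplacian N G" and ?R = "random_laplacian N G \<alpha> k"
  let ?S = "{mat_expectation N M ?R, mat_expectation N M (\<lambda>\<omega>. transpose_mat (?R \<omega>)),
    mat_expectation N M (\<lambda>\<omega>. transpose_mat (?R \<omega>) * ?R \<omega>)}"
  have L: "?L \<in> carrier_mat N N" by (simp add: laplacian_def)
  note first_moments = mat_expectation_random_laplacian[OF assms]
    mat_expectation_random_laplacian_transpose[OF assms]
  have "simultaneously_diagonalizable N ?S" if normal: "normal_mat ?L"
  proof -
    \<comment> \<open>Normality carries the zero row sums over to the columns, as the formula for
      the Gram matrix requires.\<close>
    have "(\<Sum>m<N. ?L $$ (m, j)) = 0" if "j < N" for j
      using laplacian_row_sum[OF assms(1,2)] that by (rule normal_mat_col_sum[OF L normal])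
    then show ?thesis
      unfolding first_moments by (subst mat_expectation_random_laplacian_gram[OF assms])
        (auto intro: normal_real_simultaneously_diagonalizable[OF L normal])
  qed
  moreover have "normal_mat ?L" if "p \<noteq> 0" and "simultaneously_diagonalizable N ?S"
  proof -
    \<comment> \<open>The first two expectations are thus \<open>p\<close> times \<open>L\<close>
      and the transpose of that very matrix, and the factor \<open>p\<close> can be
      cancelled.\<close>
    have "transpose_mat (p \<cdot>\<^sub>m ?L) = p \<cdot>\<^sub>m transpose_mat ?L" by (auto intro!: eq_matI)
    then have "normal_mat (p \<cdot>\<^sub>m ?L)"
      using that(2) L unfolding first_moments by (intro normal_mat_if_simultaneously_diagonalizable[of _ N ?S])
        (auto simp: first_moments)
    then show ?thesis using normal_mat_smult_iff[OF L that(1)] by blast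
  qed
  ultimately show ?thesis unfolding Let_def by blast
qed

end
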